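(* For $h\in\mathbb{N}$ with $h\geq 3$, $d\in\{4,\ldots,\lfloor e^h\rfloor\}$ even, and $\varepsilon\in\{p,1/2\}$, consider the tetranomial $$f_{d,\varepsilon}(x):=x^d-\varepsilon^{-2h}x^2+2\varepsilon^{-(h+1)}x-\varepsilon^{-2},$$ and let $H:=\max\{\varepsilon^{\pm 2h}\}$. Then $f_{d,\varepsilon}$ has distinct nonzero roots $\zeta_1,\zeta_2$ in the open unit disk of $K$ (centered at $0$) with $|\log|\zeta_1-\zeta_2|_p|=\Omega(d\log H)$ or $|\log|\zeta_1-\zeta_2||=\Omega(d\log H)$, according as $(K,\varepsilon)=(\mathbb{Q}_p,p)$ for a prime $p$ or $(K,\varepsilon)=(\mathbb{R},1/2)$. In particular, the coefficients of $p^{2h}f_{d,p}$ all lie in $\mathbb{Z}$ and have $O(\log_p H)$ base-$p$ digits, and one needs $\Omega(d\log_p H)$ many base-$p$ digits to distinguish the roots of $f_{d,p}$ in $\mathbb{Z}_p$.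
   Context: $|\cdot|_p$ is the $p$-adic absolute value normalized by $|p|_p=1/p$; $|\cdot|$ is the usual absolute value. The $\Omega$- and $O$-constants are effective and absolute. *)

theory Defs
  imports
    "HOL-Algebra.QuotRing"
    "HOL-Algebra.Polynomial_Divisibility"
    "HOL-Library.Log_Nat"
    "HOL-Computational_Algebra.Computational_Algebra"
    "HOL-Analysis.Analysis"
begin

subsection \<open>The field of p-adic numbers\<close>

definition padic_abs :: "nat \<Rightarrow> rat \<Rightarrow> real" where
  "padic_abs p q =
     (if q = 0 then 0
      else real p powi (int (multiplicity (int p) (snd (quotient_of q)))
                        - int (multiplicity (int p) (fst (quotient_of q)))))"

definition padic_Cauchy :: "nat \<Rightarrow> (nat \<Rightarrow> rat) \<Rightarrow> bool" where
  "padic_Cauchy p s \<longleftrightarrow>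
     (\<forall>e>0. \<exists>N. \<forall>m\<ge>N. \<forall>n\<ge>N. padic_abs p (s m - s n) < e)"

definition padic_Cauchy_ring :: "nat \<Rightarrow> (nat \<Rightarrow> rat) ring" where
  "padic_Cauchy_ring p =
     \<lparr>carrier = {s. padic_Cauchy p s},
      mult = (\<lambda>s t n. s n * t n), one = (\<lambda>_. 1),
      zero = (\<lambda>_. 0), add = (\<lambda>s t n. s n + t n)\<rparr>"

definition padic_null :: "nat \<Rightarrow> (nat \<Rightarrow> rat) set" where
  "padic_null p = {s. (\<lambda>n. padic_abs p (s n)) \<longlonglongrightarrow> 0}"

text \<open>
  The completion of the rationals with respect to \<^const>\<open>padic_abs\<close>.  The prime is a term
  argument rather than a type parameter, so that statements may quantify over all primes after
  an existentially quantified constant.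
\<close>

definition Qp :: "nat \<Rightarrow> (nat \<Rightarrow> rat) set ring" where
  "Qp p = padic_Cauchy_ring p Quot padic_null p"

definition padic_of_rat :: "nat \<Rightarrow> rat \<Rightarrow> (nat \<Rightarrow> rat) set" where
  "padic_of_rat p q = padic_null p +>\<^bsub>padic_Cauchy_ring p\<^esub> (\<lambda>_. q)"

definition padic_norm :: "nat \<Rightarrow> (nat \<Rightarrow> rat) set \<Rightarrow> real" where
  "padic_norm p x = (THE r. \<forall>s\<in>x. (\<lambda>n. padic_abs p (s n)) \<longlonglongrightarrow> r)"

definition Zp :: "nat \<Rightarrow> (nat \<Rightarrow> rat) set set" where
  "Zp p = {x \<in> carrier (Qp p). padic_norm p x \<le> 1}"

definition padic_digits :: "nat \<Rightarrow> (nat \<Rightarrow> rat) set \<Rightarrow> nat \<Rightarrow> nat" where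
  "padic_digits p x =
     (THE a. (\<forall>i. a i < p) \<and>
        (\<lambda>n. padic_norm p (x \<ominus>\<^bsub>Qp p\<^esub> padic_of_rat p (of_nat (\<Sum>i<n. a i * p ^ i))))
          \<longlonglongrightarrow> 0)"

definition padic_distinguishes :: "nat \<Rightarrow> nat \<Rightarrow> (nat \<Rightarrow> rat) set set \<Rightarrow> bool" where
  "padic_distinguishes p k S \<longleftrightarrow>
     (\<forall>x\<in>S. \<forall>y\<in>S. x \<noteq> y \<longrightarrow> (\<exists>i<k. padic_digits p x i \<noteq> padic_digits p y i))"

text \<open>
  Polynomials in HOL-Algebra are coefficient lists with the leading coefficient first, whereas
  \<^const>\<open>coeffs\<close> starts with the constant term.
\<close>

definition padic_poly :: "nat \<Rightarrow> rat poly \<Rightarrow> (nat \<Rightarrow> rat) set list" where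
  "padic_poly p f = map (padic_of_rat p) (rev (coeffs f))"

definition padic_root :: "nat \<Rightarrow> rat poly \<Rightarrow> (nat \<Rightarrow> rat) set \<Rightarrow> bool" where
  "padic_root p f x \<longleftrightarrow> ring.is_root (Qp p) (padic_poly p f) x"

subsection \<open>The tetranomials\<close>

definition tetranomial :: "nat \<Rightarrow> nat \<Rightarrow> 'a::field \<Rightarrow> 'a poly" where
  "tetranomial h d \<epsilon> =
     Polynomial.monom 1 d
     - Polynomial.monom (\<epsilon> powi (- 2 * int h)) 2
     + Polynomial.monom (2 * \<epsilon> powi (- (int h + 1))) 1
     - Polynomial.monom (\<epsilon> powi (- 2)) 0"

definition tetra_H :: "nat \<Rightarrow> real \<Rightarrow> real" where
  "tetra_H h \<epsilon> = max (\<epsilon> powi (2 * int h)) (\<epsilon> powi (- 2 * int h))"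

end

theory Submission
  imports Defs
begin

text \<open>
  With \<open>d = 2 * m\<close> the tetranomial is \<open>(x ^ m)\<^sup>2 - ((x - \<epsilon> ^ (h - 1)) / \<epsilon> ^ h)\<^sup>2\<close>, so its roots are the
  fixed points of the two maps \<open>x \<mapsto> \<epsilon> ^ (h - 1) \<plusminus> \<epsilon> ^ h * x ^ m\<close>.  Each map has one fixed point of size
  about \<open>\<epsilon> ^ (h - 1)\<close>, and these two differ by \<open>\<epsilon> ^ h * (\<zeta>\<^sub>1 ^ m + \<zeta>\<^sub>2 ^ m)\<close>, which has size at most about
  \<open>\<epsilon> ^ (h + m * (h - 1))\<close>.  Over the reals the fixed points come from the intermediate value theorem.
  Over the p-adic numbers they are limits of the iterates started at 0, which are integers, the
  n-th and the next one being congruent modulo \<open>p ^ n\<close>; the residues modulo \<open>p ^ n\<close> then provide the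
  p-adic digits as well.
\<close>

section \<open>The p-adic numbers\<close>

text \<open>The projection from Cauchy sequences to the completion. Working with representatives
  turns the operations of \<open>Qp p\<close> into pointwise operations on rational
  sequences.\<close>

definition padic_of_seq :: "nat \<Rightarrow> (nat \<Rightarrow> rat) \<Rightarrow> (nat \<Rightarrow> rat) set" where
  "padic_of_seq p s = padic_null p +>\<^bsub>padic_Cauchy_ring p\<^esub> s"

text \<open>The predicate under the definite description in \<open>padic_digits\<close>, named so
  that existence and uniqueness of an expansion can be proved separately.\<close>

definition is_padic_expansion :: "nat \<Rightarrow> (nat \<Rightarrow> nat) \<Rightarrow> (nat \<Rightarrow> rat) set \<Rightarrow> bool" where
  "is_padic_expansion p a x \<longleftrightarrow> (\<forall>i. a i < p) \<and>
    (\<lambda>n. padic_norm p (x \<ominus>\<^bsub>Qp p\<^esub> padic_of_rat p (of_nat (\<Sum>i<n. a i * p ^ i)))) \<longlonglongrightarrow> 0"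

text \<open>Integer representatives of an element of the inverse limit of the rings of residues
  modulo \<open>p ^ n\<close>. Unlike the Cauchy property this fixes the rate: \<open>z n\<close>
  already has its final residue modulo \<open>p ^ n\<close>.\<close>

definition padic_coherent :: "nat \<Rightarrow> (nat \<Rightarrow> int) \<Rightarrow> bool" where
  "padic_coherent p z \<longleftrightarrow> (\<forall>n. int p ^ n dvd z (Suc n) - z n)"

lemma rat_fraction_cases:
  fixes q :: rat
  obtains a b where "b \<noteq> 0" "q = of_int a / of_int b"
  by (metis quotient_of_div quotient_of_denom_pos less_irrefl surj_pair)

context
  fixes p :: nat
  assumes prime_p: "Factorial_Ring.prime p"
begin

section \<open>The p-adic absolute value on the rationals\<close>

lemma real_prime_gt_1: "real p > 1"
  using prime_p prime_gt_1_nat by simp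

lemma prime_elem_int: "prime_elem (int p)"
  using prime_p by auto

text \<open>Cross-multiplication with the reduced fraction, together with additivity of the
  multiplicity, gives the same exponent. Later computations may therefore use any fraction, in
  particular one over a common denominator.\<close>

lemma padic_abs_divide:
  assumes "a \<noteq> 0" "b \<noteq> 0"
  shows "padic_abs p (of_int a / of_int b) =
    real p powi (int (multiplicity (int p) b) - int (multiplicity (int p) a))"
proof -
  obtain u v where uv: "quotient_of (of_int a / of_int b) = (u, v)"
    by fastforce
  have v: "v > 0" and q: "(of_int a / of_int b :: rat) = of_int u / of_int v"
    using quotient_of_denom_pos[OF uv] quotient_of_div[OF uv] by auto
  have "of_int (a * v) = (of_int (u * b) :: rat)"
    using q v assms by (simp add: field_simps)
  then have eq: "a * v = u * b"
    by (rule of_int_eq_iff[THEN iffD1])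
  then have "u \<noteq> 0"
    using v assms by auto
  then have "multiplicity (int p) a + multiplicity (int p) v
    = multiplicity (int p) u + multiplicity (int p) b"
    using eq assms v prime_elem_multiplicity_mult_distrib[OF prime_elem_int] by (metis less_irrefl)
  then have "int (multiplicity (int p) v) - int (multiplicity (int p) u)
    = int (multiplicity (int p) b) - int (multiplicity (int p) a)"
    by linarith
  then show ?thesis
    using assms by (simp add: padic_abs_def uv)
qed

lemma padic_abs_of_int:
  "z \<noteq> 0 \<Longrightarrow> padic_abs p (of_int z) = real p powi (- int (multiplicity (int p) z))"
  using padic_abs_divide[of z 1] by simp

lemma padic_abs_0 [simp]: "padic_abs p 0 = 0"
  by (simp add: padic_abs_def)

lemma padic_abs_pos: "q \<noteq> 0 \<Longrightarrow> padic_abs p q > 0"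
  using real_prime_gt_1 by (simp add: padic_abs_def)

lemma padic_abs_nonneg [simp]: "padic_abs p q \<ge> 0"
  using padic_abs_pos[of q] by (cases "q = 0") auto

lemma padic_abs_mult: "padic_abs p (x * y) = padic_abs p x * padic_abs p y"
proof (cases "x = 0 \<or> y = 0")
  case False
  obtain a b where b: "b \<noteq> 0" and x: "x = of_int a / of_int b"
    by (rule rat_fraction_cases)
  obtain c d where d: "d \<noteq> 0" and y: "y = of_int c / of_int d"
    by (rule rat_fraction_cases)
  have ac: "a \<noteq> 0" "c \<noteq> 0"
    using False x y by auto
  have "x * y = of_int (a * c) / of_int (b * d)"
    by (simp add: x y)
  then have "padic_abs p (x * y) = real p powi
      (int (multiplicity (int p) (b * d)) - int (multiplicity (int p) (a * c)))"
    using padic_abs_divide[of "a * c" "b * d"] ac b d by simp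
  also have "\<dots> = padic_abs p x * padic_abs p y"
    using ac b d real_prime_gt_1
    by (simp add: x y padic_abs_divide prime_elem_multiplicity_mult_distrib[OF prime_elem_int]
        flip: power_int_add)
       (simp add: algebra_simps)
  finally show ?thesis .
qed auto

lemma padic_abs_minus [simp]: "padic_abs p (- x) = padic_abs p x"
proof -
  have "padic_abs p (-1) = 1"
    using padic_abs_of_int[of "-1"] by (simp add: multiplicity_unit_right)
  then show ?thesis
    using padic_abs_mult[of "-1" x] by simp
qed

lemma padic_abs_minus_commute: "padic_abs p (x - y) = padic_abs p (y - x)"
  using padic_abs_minus[of "x - y"] by simp

text \<open>Over a common denominator only the numerators matter, and the smaller of the two powers
  of \<open>p\<close> dividing them also divides their sum.\<close>

lemma padic_abs_add_le_max: "padic_abs p (x + y) \<le> max (padic_abs p x) (padic_abs p y)"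
proof (cases "x = 0 \<or> y = 0 \<or> x + y = 0")
  case True
  then show ?thesis
    by (auto simp: le_max_iff_disj)
next
  case False
  obtain a b where b: "b \<noteq> 0" and x: "x = of_int a / of_int b"
    by (rule rat_fraction_cases)
  obtain c d where d: "d \<noteq> 0" and y: "y = of_int c / of_int d"
    by (rule rat_fraction_cases)
  define m n where "m = multiplicity (int p) (a * d)" and "n = multiplicity (int p) (c * b)"
  have x': "x = of_int (a * d) / of_int (b * d)" and y': "y = of_int (c * b) / of_int (b * d)"
    and xy: "x + y = of_int (a * d + c * b) / of_int (b * d)"
    using b d by (simp_all add: x y field_simps)
  have nz: "a * d \<noteq> 0" "c * b \<noteq> 0" "a * d + c * b \<noteq> 0"
    using False x' y' xy by (metis div_0 of_int_0)+
  have "int p ^ min m n dvd a * d + c * b"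
    unfolding m_def n_def by (intro dvd_add multiplicity_dvd') auto
  then have "min m n \<le> multiplicity (int p) (a * d + c * b)"
    using nz prime_elem_int by (intro multiplicity_geI) auto
  \<comment> \<open>Here \<open>k\<close> stands for the multiplicity of the common denominator
    \<open>b * d\<close>.\<close>
  then have "real p powi (k - int (multiplicity (int p) (a * d + c * b)))
      \<le> max (real p powi (k - int m)) (real p powi (k - int n))" for k
    using real_prime_gt_1 by (cases "m \<le> n") (auto simp: le_max_iff_disj intro!: power_int_increasing)
  then have "padic_abs p (of_int (a * d + c * b) / of_int (b * d))
      \<le> max (padic_abs p (of_int (a * d) / of_int (b * d)))
             (padic_abs p (of_int (c * b) / of_int (b * d)))"
    unfolding m_def n_def
    using nz b d by (subst (1 2 3) padic_abs_divide) (simp_all del: of_int_mult of_int_add)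
  then show ?thesis
    by (simp only: x'[symmetric] y'[symmetric] xy[symmetric])
qed

lemma padic_abs_triangle: "padic_abs p (x + y) \<le> padic_abs p x + padic_abs p y"
  using padic_abs_add_le_max[of x y] padic_abs_nonneg[of x] padic_abs_nonneg[of y]
  by linarith

lemma padic_abs_diff_le: "\<bar>padic_abs p x - padic_abs p y\<bar> \<le> padic_abs p (x - y)"
  using padic_abs_triangle[of "x - y" y] padic_abs_triangle[of "y - x" x]
    padic_abs_minus_commute[of x y]
  by simp

text \<open>The bridge between analysis and arithmetic: through it, estimates of norms of integer
  sequences become divisibility statements.\<close>

lemma padic_abs_of_int_le_iff:
  "padic_abs p (of_int z) \<le> real p powi (- int n) \<longleftrightarrow> int p ^ n dvd z"
proof (cases "z = 0")
  case True
  then show ?thesis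
    using real_prime_gt_1 by simp
next
  case False
  have "padic_abs p (of_int z) \<le> real p powi (- int n) \<longleftrightarrow> n \<le> multiplicity (int p) z"
    using padic_abs_of_int[OF False] real_prime_gt_1
      power_int_increasing[of "- int (multiplicity (int p) z)" "- int n" "real p"]
      power_int_strict_increasing[of "- int n" "- int (multiplicity (int p) z)" "real p"]
    by (cases "n \<le> multiplicity (int p) z") auto
  also have "\<dots> \<longleftrightarrow> int p ^ n dvd z"
    using False prime_elem_int by (subst power_dvd_iff_le_multiplicity) auto
  finally show ?thesis .
qed

lemma powi_minus_tendsto_0: "(\<lambda>n. real p powi (- int n)) \<longlonglongrightarrow> 0"
  using LIMSEQ_realpow_zero[of "inverse (real p)"] real_prime_gt_1
  by (simp add: power_int_minus power_inverse inverse_less_1_iff)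

section \<open>Cauchy sequences and null sequences\<close>

lemma padic_Cauchy_convergent:
  assumes "padic_Cauchy p s"
  shows "convergent (\<lambda>n. padic_abs p (s n))"
proof (intro Cauchy_convergent CauchyI)
  fix e :: real assume "e > 0"
  then obtain N where "\<forall>m\<ge>N. \<forall>n\<ge>N. padic_abs p (s m - s n) < e"
    using assms padic_Cauchy_def by blast
  \<comment> \<open>The reverse triangle inequality carries the Cauchy property over to the real
    sequence of absolute values, which converges even when \<open>s\<close> has no rational
    limit.\<close>
  then show "\<exists>M. \<forall>m\<ge>M. \<forall>n\<ge>M. norm (padic_abs p (s m) - padic_abs p (s n)) < e"
    using padic_abs_diff_le by (metis real_norm_def order.strict_trans1)
qed

lemma padic_Cauchy_bounded:
  assumes "padic_Cauchy p s"
  obtains B where "B > 0" "\<And>n. padic_abs p (s n) \<le> B"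
  using convergent_imp_Bseq[OF padic_Cauchy_convergent[OF assms]] by (auto elim!: BseqE)

lemma padic_Cauchy_add:
  assumes "padic_Cauchy p s" "padic_Cauchy p t"
  shows "padic_Cauchy p (\<lambda>n. s n + t n)"
  unfolding padic_Cauchy_def
proof (intro allI impI)
  fix e :: real assume "e > 0"
  obtain M where M: "\<forall>m\<ge>M. \<forall>n\<ge>M. padic_abs p (s m - s n) < e"
    using assms(1) \<open>e > 0\<close> padic_Cauchy_def by blast
  obtain N where N: "\<forall>m\<ge>N. \<forall>n\<ge>N. padic_abs p (t m - t n) < e"
    using assms(2) \<open>e > 0\<close> padic_Cauchy_def by blast
  have "padic_abs p (s m + t m - (s n + t n)) < e" if "m \<ge> max M N" "n \<ge> max M N" for m n
  proof -
    have "padic_abs p (s m + t m - (s n + t n))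
        \<le> max (padic_abs p (s m - s n)) (padic_abs p (t m - t n))"
      using padic_abs_add_le_max[of "s m - s n" "t m - t n"] by (simp add: algebra_simps)
    also have "\<dots> < e"
      using M N that by simp
    finally show ?thesis .
  qed
  then show "\<exists>N. \<forall>m\<ge>N. \<forall>n\<ge>N. padic_abs p (s m + t m - (s n + t n)) < e"
    by blast
qed

lemma padic_Cauchy_mult:
  assumes "padic_Cauchy p s" "padic_Cauchy p t"
  shows "padic_Cauchy p (\<lambda>n. s n * t n)"
  unfolding padic_Cauchy_def
proof (intro allI impI)
  fix e :: real assume "e > 0"
  obtain B where B: "B > 0" "\<And>n. padic_abs p (s n) \<le> B"
    using padic_Cauchy_bounded[OF assms(1)] by blast
  obtain C where C: "C > 0" "\<And>n. padic_abs p (t n) \<le> C"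
    using padic_Cauchy_bounded[OF assms(2)] by blast
  obtain M where M: "\<forall>m\<ge>M. \<forall>n\<ge>M. padic_abs p (s m - s n) < e / C"
    using assms(1) \<open>e > 0\<close> C(1) padic_Cauchy_def by (metis divide_pos_pos)
  obtain N where N: "\<forall>m\<ge>N. \<forall>n\<ge>N. padic_abs p (t m - t n) < e / B"
    using assms(2) \<open>e > 0\<close> B(1) padic_Cauchy_def by (metis divide_pos_pos)
  have "padic_abs p (s m * t m - s n * t n) < e" if "m \<ge> max M N" "n \<ge> max M N" for m n
  proof -
    have "s m * t m - s n * t n = s m * (t m - t n) + (s m - s n) * t n"
      by (simp add: algebra_simps)
    then have "padic_abs p (s m * t m - s n * t n)
        \<le> max (padic_abs p (s m) * padic_abs p (t m - t n))
              (padic_abs p (s m - s n) * padic_abs p (t n))"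
      by (metis padic_abs_add_le_max padic_abs_mult)
    also have "\<dots> \<le> max (B * padic_abs p (t m - t n)) (padic_abs p (s m - s n) * C)"
      using B C by (intro max.mono mult_mono) (auto simp: less_imp_le)
    also have "\<dots> < e"
      using M N B(1) C(1) that by (simp add: field_simps)
    finally show ?thesis .
  qed
  then show "\<exists>N. \<forall>m\<ge>N. \<forall>n\<ge>N. padic_abs p (s m * t m - s n * t n) < e"
    by blast
qed

lemma padic_Cauchy_const: "padic_Cauchy p (\<lambda>_. q)"
  by (auto simp: padic_Cauchy_def)

lemma padic_Cauchy_uminus: "padic_Cauchy p s \<Longrightarrow> padic_Cauchy p (\<lambda>n. - s n)"
  using padic_Cauchy_mult[OF padic_Cauchy_const[of "-1"]] by simp

lemma padic_Cauchy_diff: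
  "padic_Cauchy p s \<Longrightarrow> padic_Cauchy p t \<Longrightarrow> padic_Cauchy p (\<lambda>n. s n - t n)"
  using padic_Cauchy_add[OF _ padic_Cauchy_uminus, of s t] by simp

lemma padic_null_imp_Cauchy:
  assumes "s \<in> padic_null p"
  shows "padic_Cauchy p s"
  unfolding padic_Cauchy_def
proof (intro allI impI)
  fix e :: real assume "e > 0"
  then obtain N where N: "\<forall>n\<ge>N. padic_abs p (s n) < e"
    using assms LIMSEQ_D[of "\<lambda>n. padic_abs p (s n)" 0 e] by (auto simp: padic_null_def)
  have "padic_abs p (s m - s n) < e" if "m \<ge> N" "n \<ge> N" for m n
    using padic_abs_add_le_max[of "s m" "- s n"] N that by (metis add_uminus_conv_diff
        max_less_iff_conj order.strict_trans1 padic_abs_minus)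
  then show "\<exists>N. \<forall>m\<ge>N. \<forall>n\<ge>N. padic_abs p (s m - s n) < e"
    by blast
qed

lemma padic_null_add:
  assumes "s \<in> padic_null p" "t \<in> padic_null p"
  shows "(\<lambda>n. s n + t n) \<in> padic_null p"
proof -
  have lim: "(\<lambda>n. padic_abs p (s n) + padic_abs p (t n)) \<longlonglongrightarrow> 0"
    using tendsto_add[of "\<lambda>n. padic_abs p (s n)" 0 sequentially "\<lambda>n. padic_abs p (t n)" 0] assms
    by (simp add: padic_null_def)
  show ?thesis
    unfolding padic_null_def mem_Collect_eq
    by (rule Lim_null_comparison[OF always_eventually lim]) (simp add: padic_abs_triangle)
qed

lemma padic_null_mult:
  assumes "s \<in> padic_null p" "padic_Cauchy p t"
  shows "(\<lambda>n. s n * t n) \<in> padic_null p"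
proof -
  obtain B where "\<And>n. padic_abs p (t n) \<le> B"
    using padic_Cauchy_bounded[OF assms(2)] by blast
  then have B: "padic_abs p (s n * t n) \<le> padic_abs p (s n) * B" for n
    by (simp add: padic_abs_mult mult_left_mono)
  have lim: "(\<lambda>n. padic_abs p (s n) * B) \<longlonglongrightarrow> 0"
    using assms(1) tendsto_mult_left_zero by (auto simp: padic_null_def)
  show ?thesis
    unfolding padic_null_def mem_Collect_eq
    by (rule Lim_null_comparison[OF always_eventually lim]) (simp add: B)
qed

section \<open>The ring of Cauchy sequences and its quotient\<close>

lemma cring_padic_Cauchy_ring: "cring (padic_Cauchy_ring p)"
proof (rule cringI)
  show "abelian_group (padic_Cauchy_ring p)"
  proof (rule abelian_groupI)
    fix s assume "s \<in> carrier (padic_Cauchy_ring p)"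
    then show "\<exists>t\<in>carrier (padic_Cauchy_ring p).
        t \<oplus>\<^bsub>padic_Cauchy_ring p\<^esub> s = \<zero>\<^bsub>padic_Cauchy_ring p\<^esub>"
      using padic_Cauchy_uminus[of s]
      by (intro bexI[of _ "\<lambda>n. - s n"]) (auto simp: padic_Cauchy_ring_def)
  qed (auto simp: padic_Cauchy_ring_def padic_Cauchy_add padic_Cauchy_const algebra_simps)
  show "Group.comm_monoid (padic_Cauchy_ring p)"
    by (rule comm_monoidI)
       (auto simp: padic_Cauchy_ring_def padic_Cauchy_mult padic_Cauchy_const algebra_simps)
qed (auto simp: padic_Cauchy_ring_def algebra_simps)

interpretation Cauchy: cring "padic_Cauchy_ring p"
  by (rule cring_padic_Cauchy_ring)

lemma padic_Cauchy_ring_uminus: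
  assumes "padic_Cauchy p s"
  shows "\<ominus>\<^bsub>padic_Cauchy_ring p\<^esub> s = (\<lambda>n. - s n)"
  using Cauchy.minus_equality[of "\<lambda>n. - s n" s] assms padic_Cauchy_uminus[OF assms]
  by (auto simp: padic_Cauchy_ring_def)

lemma ideal_padic_null: "ideal (padic_null p) (padic_Cauchy_ring p)"
proof (rule idealI)
  show "subgroup (padic_null p) (add_monoid (padic_Cauchy_ring p))"
  proof (rule group.subgroupI)
    show "Group.group (add_monoid (padic_Cauchy_ring p))"
      by (rule Cauchy.a_group)
    show "padic_null p \<subseteq> carrier (add_monoid (padic_Cauchy_ring p))"
      using padic_null_imp_Cauchy by (auto simp: padic_Cauchy_ring_def)
    show "padic_null p \<noteq> {}"
      by (auto simp: padic_null_def intro!: exI[of _ "\<lambda>_. 0"])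
    fix s assume s: "s \<in> padic_null p"
    then have "(\<lambda>n. - s n) \<in> padic_null p"
      by (simp add: padic_null_def)
    then show "inv\<^bsub>add_monoid (padic_Cauchy_ring p)\<^esub> s \<in> padic_null p"
      using padic_Cauchy_ring_uminus[OF padic_null_imp_Cauchy[OF s]] by (simp add: a_inv_def)
  next
    fix s t assume "s \<in> padic_null p" "t \<in> padic_null p"
    then show "s \<otimes>\<^bsub>add_monoid (padic_Cauchy_ring p)\<^esub> t \<in> padic_null p"
      using padic_null_add by (simp add: padic_Cauchy_ring_def)
  qed
qed (use padic_null_mult Cauchy.ring_axioms in \<open>auto simp: padic_Cauchy_ring_def mult.commute\<close>)

interpretation null: ideal "padic_null p" "padic_Cauchy_ring p"
  by (rule ideal_padic_null)

lemma padic_of_rat_eq_of_seq: "padic_of_rat p q = padic_of_seq p (\<lambda>_. q)"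
  by (simp add: padic_of_rat_def padic_of_seq_def)

lemma ring_hom_padic_of_seq: "ring_hom_ring (padic_Cauchy_ring p) (Qp p) (padic_of_seq p)"
  using null.rcos_ring_hom_ring by (simp add: Qp_def padic_of_seq_def[abs_def])

text \<open>Provides the homomorphism laws and, under the prefix \<open>seq.S\<close>, the ring
  theory of \<open>Qp p\<close> itself.\<close>

interpretation seq: ring_hom_ring "padic_Cauchy_ring p" "Qp p" "padic_of_seq p"
  by (rule ring_hom_padic_of_seq)

lemma padic_of_seq_closed: "padic_Cauchy p s \<Longrightarrow> padic_of_seq p s \<in> carrier (Qp p)"
  using seq.hom_closed by (simp add: padic_Cauchy_ring_def)

lemma padic_of_seq_add:
  "padic_Cauchy p s \<Longrightarrow> padic_Cauchy p t \<Longrightarrow>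
    padic_of_seq p s \<oplus>\<^bsub>Qp p\<^esub> padic_of_seq p t = padic_of_seq p (\<lambda>n. s n + t n)"
  using seq.hom_add[of s t] by (simp add: padic_Cauchy_ring_def)

lemma padic_of_seq_mult:
  "padic_Cauchy p s \<Longrightarrow> padic_Cauchy p t \<Longrightarrow>
    padic_of_seq p s \<otimes>\<^bsub>Qp p\<^esub> padic_of_seq p t = padic_of_seq p (\<lambda>n. s n * t n)"
  using seq.hom_mult[of s t] by (simp add: padic_Cauchy_ring_def)

lemma padic_of_seq_diff:
  assumes "padic_Cauchy p s" "padic_Cauchy p t"
  shows "padic_of_seq p s \<ominus>\<^bsub>Qp p\<^esub> padic_of_seq p t = padic_of_seq p (\<lambda>n. s n - t n)"
proof -
  have "\<ominus>\<^bsub>Qp p\<^esub> padic_of_seq p t = padic_of_seq p (\<lambda>n. - t n)"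
    using seq.hom_a_inv[of t] assms by (simp add: padic_Cauchy_ring_uminus)
       (simp add: padic_Cauchy_ring_def)
  then show ?thesis
    using padic_of_seq_add[OF assms(1) padic_Cauchy_uminus[OF assms(2)]]
    by (simp add: a_minus_def)
qed

lemma padic_of_seq_const_0: "padic_of_seq p (\<lambda>_. 0) = \<zero>\<^bsub>Qp p\<^esub>"
  using seq.hom_zero by (simp add: padic_Cauchy_ring_def)

lemma padic_of_seq_eq_zero_iff:
  assumes "padic_Cauchy p s"
  shows "padic_of_seq p s = \<zero>\<^bsub>Qp p\<^esub> \<longleftrightarrow> s \<in> padic_null p"
proof -
  have zero: "\<zero>\<^bsub>Qp p\<^esub> = padic_null p"
    by (simp add: Qp_def FactRing_def)
  show ?thesis
    unfolding zero padic_of_seq_def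
    using assms Cauchy.a_coset_join1[of "padic_null p" s] Cauchy.a_rcos_zero[OF ideal_padic_null]
      null.a_subgroup
    by (auto simp: padic_Cauchy_ring_def)
qed

section \<open>Representing sequences and the p-adic norm\<close>

lemma padic_of_seq_cases:
  assumes "x \<in> carrier (Qp p)"
  obtains s where "padic_Cauchy p s" "x = padic_of_seq p s"
  using assms
  by (auto simp: Qp_def FactRing_def A_RCOSETS_def' padic_of_seq_def padic_Cauchy_ring_def)

text \<open>Two representatives of a class differ by a null sequence, so their absolute values have
  the same limit. Since \<open>s\<close> lies in its own class, this limit is the only candidate,
  which resolves the definite description in \<open>padic_norm\<close>.\<close>

lemma padic_norm_of_seq:
  assumes "(\<lambda>n. padic_abs p (s n)) \<longlonglongrightarrow> r"
  shows "padic_norm p (padic_of_seq p s) = r"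
proof -
  have mem: "t \<in> padic_of_seq p s \<longleftrightarrow> (\<exists>u\<in>padic_null p. t = (\<lambda>n. u n + s n))" for t
    by (auto simp: padic_of_seq_def a_r_coset_def' padic_Cauchy_ring_def)
  have lim: "(\<lambda>n. padic_abs p (t n)) \<longlonglongrightarrow> r" if t: "t \<in> padic_of_seq p s" for t
  proof -
    obtain u where u: "u \<in> padic_null p" and t_eq: "t = (\<lambda>n. u n + s n)"
      using t mem by blast
    have "(\<lambda>n. padic_abs p (t n) - padic_abs p (s n)) \<longlonglongrightarrow> 0"
    proof (rule Lim_null_comparison[OF always_eventually])
      show "\<forall>n. norm (padic_abs p (t n) - padic_abs p (s n)) \<le> padic_abs p (u n)"
        unfolding t_eq real_norm_def by (metis padic_abs_diff_le add_diff_cancel_right')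
      show "(\<lambda>n. padic_abs p (u n)) \<longlonglongrightarrow> 0"
        using u by (simp add: padic_null_def)
    qed
    from tendsto_add[OF this assms] show ?thesis
      by simp
  qed
  have "s \<in> padic_of_seq p s"
    unfolding mem by (rule bexI[of _ "\<lambda>_. 0"]) (auto simp: padic_null_def)
  with lim show ?thesis
    unfolding padic_norm_def using assms LIMSEQ_unique by (intro the_equality) blast+
qed

lemma padic_norm_tendsto:
  assumes "padic_Cauchy p s"
  shows "(\<lambda>n. padic_abs p (s n)) \<longlonglongrightarrow> padic_norm p (padic_of_seq p s)"
  using padic_Cauchy_convergent[OF assms] padic_norm_of_seq by (auto simp: convergent_def)

lemma padic_norm_of_rat: "padic_norm p (padic_of_rat p q) = padic_abs p q"
  unfolding padic_of_rat_eq_of_seq by (rule padic_norm_of_seq) simp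

lemma padic_norm_nonneg: "x \<in> carrier (Qp p) \<Longrightarrow> padic_norm p x \<ge> 0"
  by (metis LIMSEQ_le_const padic_abs_nonneg padic_norm_tendsto padic_of_seq_cases)

lemma padic_norm_pos:
  assumes "x \<in> carrier (Qp p)" "x \<noteq> \<zero>\<^bsub>Qp p\<^esub>"
  shows "padic_norm p x > 0"
proof -
  obtain s where s: "padic_Cauchy p s" "x = padic_of_seq p s"
    using padic_of_seq_cases[OF assms(1)] by blast
  have "padic_norm p x \<noteq> 0"
    using padic_norm_tendsto[OF s(1)] padic_of_seq_eq_zero_iff[OF s(1)] assms(2) s(2)
    by (auto simp: padic_null_def)
  then show ?thesis
    using padic_norm_nonneg[OF assms(1)] by simp
qed

text \<open>The ultrametric inequality holds termwise for representatives and passes to the limit.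
  The three-point form suits the later comparison of distances.\<close>

lemma padic_norm_diff_le_max:
  assumes "x \<in> carrier (Qp p)" "y \<in> carrier (Qp p)" "z \<in> carrier (Qp p)"
  shows "padic_norm p (x \<ominus>\<^bsub>Qp p\<^esub> z)
    \<le> max (padic_norm p (x \<ominus>\<^bsub>Qp p\<^esub> y)) (padic_norm p (y \<ominus>\<^bsub>Qp p\<^esub> z))"
proof -
  obtain s t u where s: "padic_Cauchy p s" "x = padic_of_seq p s"
    and t: "padic_Cauchy p t" "y = padic_of_seq p t"
    and u: "padic_Cauchy p u" "z = padic_of_seq p u"
    using assms by (metis padic_of_seq_cases)
  have "padic_abs p (s n - u n) \<le> max (padic_abs p (s n - t n)) (padic_abs p (t n - u n))" for n
    using padic_abs_add_le_max[of "s n - t n" "t n - u n"] by simp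
  then show ?thesis
    unfolding s(2) t(2) u(2) padic_of_seq_diff[OF s(1) t(1)] padic_of_seq_diff[OF t(1) u(1)]
      padic_of_seq_diff[OF s(1) u(1)]
    by (intro LIMSEQ_le[OF padic_norm_tendsto tendsto_max[OF padic_norm_tendsto padic_norm_tendsto]]
        padic_Cauchy_diff s t u) auto
qed

lemma padic_norm_minus_commute:
  assumes "x \<in> carrier (Qp p)" "y \<in> carrier (Qp p)"
  shows "padic_norm p (x \<ominus>\<^bsub>Qp p\<^esub> y) = padic_norm p (y \<ominus>\<^bsub>Qp p\<^esub> x)"
proof -
  obtain s t where s: "padic_Cauchy p s" "x = padic_of_seq p s"
    and t: "padic_Cauchy p t" "y = padic_of_seq p t"
    using assms by (metis padic_of_seq_cases)
  have "(\<lambda>n. padic_abs p (s n - t n)) \<longlonglongrightarrow> padic_norm p (padic_of_seq p (\<lambda>n. t n - s n))"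
    using padic_norm_tendsto[OF padic_Cauchy_diff[OF t(1) s(1)]]
    by (subst padic_abs_minus_commute)
  then show ?thesis
    by (simp add: s t padic_of_seq_diff padic_norm_of_seq)
qed

section \<open>Evaluation of polynomials and roots in \<open>Qp p\<close>\<close>

lemma padic_Cauchy_poly: "padic_Cauchy p s \<Longrightarrow> padic_Cauchy p (\<lambda>n. poly f (s n))"
  by (induction f) (simp_all add: padic_Cauchy_const padic_Cauchy_add padic_Cauchy_mult)

text \<open>With the leading coefficient first, \<open>pCons\<close> appends the new constant term
  at the end of the list, and evaluating the longer list is one Horner step.\<close>

lemma eval_padic_poly:
  assumes "padic_Cauchy p s"
  shows "ring.eval (Qp p) (padic_poly p f) (padic_of_seq p s) = padic_of_seq p (\<lambda>n. poly f (s n))"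
proof (induction f)
  case 0
  then show ?case
    by (simp add: padic_poly_def padic_of_seq_const_0)
next
  case (pCons a f)
  \<comment> \<open>\<open>pCons.hyps\<close> excludes \<open>a = 0\<close> with
    \<open>f = 0\<close>, where \<open>coeffs\<close> would return the empty list.\<close>
  have "padic_poly p (pCons a f) = padic_poly p f @ [padic_of_rat p a]"
    using pCons.hyps by (auto simp: padic_poly_def cCons_def)
  moreover have "set (padic_poly p f) \<subseteq> carrier (Qp p)"
    by (auto simp: padic_poly_def padic_of_rat_eq_of_seq intro: padic_of_seq_closed padic_Cauchy_const)
  ultimately have "ring.eval (Qp p) (padic_poly p (pCons a f)) (padic_of_seq p s)
      = padic_of_seq p (\<lambda>n. poly f (s n)) \<otimes>\<^bsub>Qp p\<^esub> padic_of_seq p s \<oplus>\<^bsub>Qp p\<^esub> padic_of_seq p (\<lambda>_. a)"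
    using assms pCons.IH
    by (simp add: seq.S.eval_append_aux padic_of_rat_eq_of_seq padic_of_seq_closed padic_Cauchy_const)
  also have "\<dots> = padic_of_seq p (\<lambda>n. poly (pCons a f) (s n))"
    using assms by (simp add: padic_of_seq_mult padic_of_seq_add padic_Cauchy_poly padic_Cauchy_mult
        padic_Cauchy_const algebra_simps)
  finally show ?case .
qed

text \<open>A root is obtained from approximations at which the polynomial tends p-adically to 0.
  The premise \<open>f \<noteq> 0\<close> is needed because \<open>is_root\<close> rejects the empty
  coefficient list.\<close>

lemma padic_rootI:
  assumes "padic_Cauchy p s" "f \<noteq> 0" "(\<lambda>n. poly f (s n)) \<in> padic_null p"
  shows "padic_root p f (padic_of_seq p s)"
  unfolding padic_root_def seq.S.is_root_def
  using assms eval_padic_poly[OF assms(1), of f] padic_of_seq_eq_zero_iff[OF padic_Cauchy_poly]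
  by (auto simp: padic_of_seq_closed padic_poly_def)

section \<open>Convergence of integer sequences in terms of divisibility\<close>

lemma padic_null_of_int_iff:
  "(\<lambda>n. of_int (z n)) \<in> padic_null p \<longleftrightarrow> (\<forall>k. \<forall>\<^sub>F n in sequentially. int p ^ k dvd z n)"
proof
  assume null: "(\<lambda>n. of_int (z n)) \<in> padic_null p"
  show "\<forall>k. \<forall>\<^sub>F n in sequentially. int p ^ k dvd z n"
  proof
    fix k
    have "\<forall>\<^sub>F n in sequentially. padic_abs p (of_int (z n)) < real p powi (- int k)"
      using null real_prime_gt_1 by (intro order_tendstoD(2)) (auto simp: padic_null_def)
    then show "\<forall>\<^sub>F n in sequentially. int p ^ k dvd z n"
      by eventually_elim (simp only: padic_abs_of_int_le_iff[symmetric] less_imp_le)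
  qed
next
  assume dvd: "\<forall>k. \<forall>\<^sub>F n in sequentially. int p ^ k dvd z n"
  have "(\<lambda>n. padic_abs p (of_int (z n))) \<longlonglongrightarrow> 0"
  proof (rule order_tendstoI)
    fix e :: real assume "e > 0"
    then obtain k where k: "real p powi (- int k) < e"
      using order_tendstoD(2)[OF powi_minus_tendsto_0] eventually_happens'[OF sequentially_bot]
      by blast
    from dvd have "\<forall>\<^sub>F n in sequentially. int p ^ k dvd z n" ..
    then show "\<forall>\<^sub>F n in sequentially. padic_abs p (of_int (z n)) < e"
      by eventually_elim (use k in \<open>metis padic_abs_of_int_le_iff order.strict_trans1\<close>)
  next
    fix e :: real assume "e < 0"
    then show "\<forall>\<^sub>F n in sequentially. e < padic_abs p (of_int (z n))"
      by (intro always_eventually allI) (metis order.strict_trans2 padic_abs_nonneg)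
  qed
  then show "(\<lambda>n. of_int (z n)) \<in> padic_null p"
    by (simp add: padic_null_def)
qed

lemma padic_norm_of_int_seq_le:
  assumes "padic_Cauchy p (\<lambda>n. of_int (z n))" "\<forall>\<^sub>F n in sequentially. int p ^ k dvd z n"
  shows "padic_norm p (padic_of_seq p (\<lambda>n. of_int (z n))) \<le> real p powi (- int k)"
  using assms(2) by (intro tendsto_upperbound[OF padic_norm_tendsto[OF assms(1)]])
    (simp_all add: padic_abs_of_int_le_iff)

lemma padic_coherent_dvd:
  assumes "padic_coherent p z" "n \<le> k"
  shows "int p ^ n dvd z k - z n"
  using assms(2)
proof (induction k rule: dec_induct)
  case (step k)
  have "int p ^ n dvd z (Suc k) - z k"
    using assms(1) step.hyps le_imp_power_dvd dvd_trans unfolding padic_coherent_def by blast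
  from dvd_add[OF this step.IH] show ?case
    by simp
qed simp

lemma padic_coherent_Cauchy:
  assumes "padic_coherent p z"
  shows "padic_Cauchy p (\<lambda>n. of_int (z n))"
  unfolding padic_Cauchy_def
proof (intro allI impI)
  fix e :: real assume "e > 0"
  then obtain N where N: "real p powi (- int N) < e"
    using order_tendstoD(2)[OF powi_minus_tendsto_0] eventually_happens'[OF sequentially_bot]
    by blast
  have "padic_abs p (of_int (z m) - of_int (z n)) < e" if "m \<ge> N" "n \<ge> N" for m n
  proof -
    have "int p ^ N dvd (z m - z N) - (z n - z N)"
      using dvd_diff[OF padic_coherent_dvd[OF assms that(1)] padic_coherent_dvd[OF assms that(2)]] .
    then have "padic_abs p (of_int (z m - z n)) \<le> real p powi (- int N)"
      by (simp only: padic_abs_of_int_le_iff) simp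
    then show ?thesis
      using N by simp
  qed
  then show "\<exists>N. \<forall>m\<ge>N. \<forall>n\<ge>N. padic_abs p (of_int (z m) - of_int (z n)) < e"
    by blast
qed

section \<open>Base-p digits\<close>

lemma digit_sum_less:
  assumes "\<And>i. a i < p"
  shows "(\<Sum>i<n. a i * p ^ i) < p ^ n"
proof (induction n)
  case (Suc n)
  have "(\<Sum>i<Suc n. a i * p ^ i) < (a n + 1) * p ^ n"
    using Suc by simp
  also have "\<dots> \<le> p * p ^ n"
    using assms[of n] by (intro mult_right_mono) auto
  finally show ?case
    by simp
qed simp

text \<open>Digits from position \<open>k\<close> on contribute multiples of \<open>p ^ k\<close>,
  and the remaining sum is already a reduced residue.\<close>

lemma digit_sum_mod:
  assumes "\<And>i. a i < p" "k \<le> n"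
  shows "(\<Sum>i<n. a i * p ^ i) mod p ^ k = (\<Sum>i<k. a i * p ^ i)"
  using assms(2)
proof (induction n rule: dec_induct)
  case base
  then show ?case
    using digit_sum_less[OF assms(1)] by simp
next
  case (step n)
  have "p ^ k dvd a n * p ^ n"
    using step.hyps by (simp add: le_imp_power_dvd)
  then show ?case
    using step.IH mod_add_right_eq[of "\<Sum>i<n. a i * p ^ i" "a n * p ^ n" "p ^ k"] by simp
qed

text \<open>Long truncations approximate \<open>x\<close> and \<open>y\<close>, so by the
  ultrametric inequality they are congruent modulo \<open>p ^ N\<close>; their residues modulo
  \<open>p ^ k\<close> are the shorter truncations. With \<open>x = y\<close> this yields uniqueness
  of the digits, and with two close roots it yields a common initial block.\<close>

lemma padic_expansions_agree:
  assumes "x \<in> carrier (Qp p)" "y \<in> carrier (Qp p)"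
    and "is_padic_expansion p a x" "is_padic_expansion p b y"
    and "padic_norm p (x \<ominus>\<^bsub>Qp p\<^esub> y) \<le> real p powi (- int N)" "i < N"
  shows "a i = b i"
proof -
  define A where "A n = (\<Sum>i<n. a i * p ^ i)" for n
  define B where "B n = (\<Sum>i<n. b i * p ^ i)" for n
  have digits: "\<And>i. a i < p" "\<And>i. b i < p"
    and lims: "(\<lambda>n. padic_norm p (x \<ominus>\<^bsub>Qp p\<^esub> padic_of_rat p (of_nat (A n)))) \<longlonglongrightarrow> 0"
      "(\<lambda>n. padic_norm p (y \<ominus>\<^bsub>Qp p\<^esub> padic_of_rat p (of_nat (B n)))) \<longlonglongrightarrow> 0"
    using assms(3,4) by (auto simp: is_padic_expansion_def A_def B_def)
  \<comment> \<open>The extra condition \<open>n \<ge> N\<close> lets \<open>digit_sum_mod\<close>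
    recover all truncations up to length \<open>N\<close>.\<close>
  have "\<forall>\<^sub>F n in sequentially. padic_norm p (x \<ominus>\<^bsub>Qp p\<^esub> padic_of_rat p (of_nat (A n))) < real p powi (- int N)
      \<and> padic_norm p (y \<ominus>\<^bsub>Qp p\<^esub> padic_of_rat p (of_nat (B n))) < real p powi (- int N) \<and> n \<ge> N"
    using real_prime_gt_1
    by (intro eventually_conj order_tendstoD(2)[OF lims(1)] order_tendstoD(2)[OF lims(2)]
        eventually_ge_at_top) auto
  then obtain n where n: "n \<ge> N"
    and An: "padic_norm p (x \<ominus>\<^bsub>Qp p\<^esub> padic_of_rat p (of_nat (A n))) < real p powi (- int N)"
    and Bn: "padic_norm p (y \<ominus>\<^bsub>Qp p\<^esub> padic_of_rat p (of_nat (B n))) < real p powi (- int N)"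
    using eventually_happens'[OF sequentially_bot] by blast
  have closed: "padic_of_rat p q \<in> carrier (Qp p)" for q
    by (simp add: padic_of_rat_eq_of_seq padic_of_seq_closed padic_Cauchy_const)
  have "padic_norm p (x \<ominus>\<^bsub>Qp p\<^esub> padic_of_rat p (of_nat (B n))) \<le> real p powi (- int N)"
    using padic_norm_diff_le_max[OF assms(1,2) closed[of "of_nat (B n)"]] assms(5) Bn
    by linarith
  then have "padic_norm p (padic_of_rat p (of_nat (A n)) \<ominus>\<^bsub>Qp p\<^esub> padic_of_rat p (of_nat (B n)))
      \<le> real p powi (- int N)"
    using padic_norm_diff_le_max[OF closed[of "of_nat (A n)"] assms(1) closed[of "of_nat (B n)"]] An
      padic_norm_minus_commute[OF assms(1) closed[of "of_nat (A n)"]]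
    by linarith
  moreover have "padic_of_rat p (of_nat (A n)) \<ominus>\<^bsub>Qp p\<^esub> padic_of_rat p (of_nat (B n))
      = padic_of_rat p (of_int (int (A n) - int (B n)))"
    by (simp add: padic_of_rat_eq_of_seq padic_of_seq_diff padic_Cauchy_const)
  ultimately have "int p ^ N dvd int (A n) - int (B n)"
    by (simp only: padic_norm_of_rat padic_abs_of_int_le_iff)
  then have AB: "A k = B k" if "k \<le> N" for k
  proof -
    have "int p ^ k dvd int (A n) - int (B n)"
      using \<open>int p ^ N dvd _\<close> that le_imp_power_dvd dvd_trans by blast
    then have "int (A n mod p ^ k) = int (B n mod p ^ k)"
      by (simp add: zmod_int mod_eq_dvd_iff)
    then have "A n mod p ^ k = B n mod p ^ k"
      by (simp only: of_nat_eq_iff)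
    then show ?thesis
      using digit_sum_mod[where a = a, OF digits(1)] digit_sum_mod[where a = b, OF digits(2)] n that
      by (simp add: A_def B_def)
  qed
  \<comment> \<open>Consecutive truncations differ by a single digit times
    \<open>p ^ i\<close>.\<close>
  have "A (Suc i) = B (Suc i)" "A i = B i"
    using AB \<open>i < N\<close> by auto
  then show ?thesis
    using real_prime_gt_1 by (simp add: A_def B_def)
qed

lemma padic_digits_eq:
  assumes "x \<in> carrier (Qp p)" "is_padic_expansion p a x"
  shows "padic_digits p x = a"
proof -
  have "x \<ominus>\<^bsub>Qp p\<^esub> x = \<zero>\<^bsub>Qp p\<^esub>"
    using assms(1) by (simp add: seq.S.r_neg a_minus_def)
  then have "padic_norm p (x \<ominus>\<^bsub>Qp p\<^esub> x) = 0"
    using padic_norm_of_rat[of 0] by (simp add: padic_of_rat_eq_of_seq padic_of_seq_const_0)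
  \<comment> \<open>Distance 0 is below every power of \<open>p\<close>, so any two expansions of
    \<open>x\<close> agree in every position.\<close>
  then have "padic_norm p (x \<ominus>\<^bsub>Qp p\<^esub> x) \<le> real p powi (- int N)" for N
    using real_prime_gt_1 by simp
  then have unique: "b = a" if "is_padic_expansion p b x" for b
    using padic_expansions_agree[OF assms(1,1) that assms(2)] by blast
  have "padic_digits p x = (THE a. is_padic_expansion p a x)"
    by (simp add: padic_digits_def is_padic_expansion_def)
  also have "\<dots> = a"
    using assms(2) unique by (rule the_equality)
  finally show ?thesis .
qed

text \<open>Digit \<open>i\<close> is read off \<open>z (Suc i)\<close>, the first term whose
  residue modulo \<open>p ^ (i + 1)\<close> is final. The truncations then equal
  \<open>z n mod int p ^ n\<close>, which converges to the same limit as \<open>z n\<close>.\<close>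

lemma padic_coherent_expansion:
  assumes "padic_coherent p z"
  shows "is_padic_expansion p (\<lambda>i. nat (z (Suc i) div int p ^ i mod int p))
    (padic_of_seq p (\<lambda>n. of_int (z n)))"
proof -
  define a where "a = (\<lambda>i. nat (z (Suc i) div int p ^ i mod int p))"
  have p0: "int p > 0"
    using real_prime_gt_1 by simp
  have a: "int (a i) = z (Suc i) div int p ^ i mod int p" for i
    using p0 by (simp add: a_def)
  have "int (a i) < int p" for i
    unfolding a using p0 by simp
  then have a_less: "a i < p" for i
    by simp
  have sum: "int (\<Sum>i<n. a i * p ^ i) = z n mod int p ^ n" for n
  proof (induction n)
    case (Suc n)
    have "z n mod int p ^ n = z (Suc n) mod int p ^ n"
      using assms by (metis mod_eq_dvd_iff padic_coherent_def)
    then have "int (\<Sum>i<Suc n. a i * p ^ i)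
        = int p ^ n * (z (Suc n) div int p ^ n mod int p) + z (Suc n) mod int p ^ n"
      using Suc by (simp add: a)
    also have "\<dots> = z (Suc n) mod (int p ^ n * int p)"
      by (rule zmod_zmult2_eq[symmetric]) simp
    finally show ?case
      by (simp add: mult.commute)
  qed simp
  have norm_le: "padic_norm p (padic_of_seq p (\<lambda>n. of_int (z n))
      \<ominus>\<^bsub>Qp p\<^esub> padic_of_rat p (of_nat (\<Sum>i<n. a i * p ^ i))) \<le> real p powi (- int n)" for n
  proof -
    have "(of_nat (\<Sum>i<n. a i * p ^ i) :: rat) = of_int (z n mod int p ^ n)"
      using sum[of n] by (metis of_int_of_nat_eq)
    then have eq: "padic_of_seq p (\<lambda>n. of_int (z n)) \<ominus>\<^bsub>Qp p\<^esub> padic_of_rat p (of_nat (\<Sum>i<n. a i * p ^ i))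
        = padic_of_seq p (\<lambda>k. of_int (z k - z n mod int p ^ n))"
      using padic_coherent_Cauchy[OF assms]
      by (simp add: padic_of_rat_eq_of_seq padic_of_seq_diff padic_Cauchy_const)
    have "\<forall>\<^sub>F k in sequentially. int p ^ n dvd z k - z n mod int p ^ n"
      using eventually_ge_at_top[of n]
    proof eventually_elim
      case (elim k)
      then show ?case
        using padic_coherent_dvd[OF assms elim] by (metis mod_eq_dvd_iff mod_mod_trivial)
    qed
    moreover have "padic_Cauchy p (\<lambda>k. of_int (z k - z n mod int p ^ n))"
      using padic_Cauchy_add[OF padic_coherent_Cauchy[OF assms]
          padic_Cauchy_const[of "- of_int (z n mod int p ^ n)"]] by simp
    ultimately show ?thesis
      unfolding eq by (intro padic_norm_of_int_seq_le)
  qed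
  let ?r = "\<lambda>n. padic_of_seq p (\<lambda>n. of_int (z n))
      \<ominus>\<^bsub>Qp p\<^esub> padic_of_rat p (of_nat (\<Sum>i<n. a i * p ^ i))"
  have "?r n \<in> carrier (Qp p)" for n
    by (simp add: padic_of_rat_eq_of_seq padic_of_seq_closed padic_Cauchy_const
        padic_coherent_Cauchy[OF assms])
  then have "(\<lambda>n. padic_norm p (?r n)) \<longlonglongrightarrow> 0"
    using norm_le padic_norm_nonneg
    by (intro Lim_null_comparison[OF always_eventually powi_minus_tendsto_0]) simp
  then show ?thesis
    using a_less by (simp add: is_padic_expansion_def a_def)
qed

end

section \<open>The tetranomials\<close>

lemma tetranomial_eq:
  "tetranomial h d \<epsilon> = Polynomial.monom 1 d - Polynomial.monom (1 / \<epsilon> ^ (2 * h)) 2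
     + Polynomial.monom (2 / \<epsilon> ^ (h + 1)) 1 - Polynomial.monom (1 / \<epsilon> ^ 2) 0"
proof -
  have powi: "\<epsilon> powi (- int n) = 1 / \<epsilon> ^ n" for n
    by (simp add: power_int_minus divide_inverse)
  show ?thesis
    unfolding tetranomial_def using powi[of "2 * h"] powi[of "h + 1"] powi[of 2]
    by (simp add: algebra_simps del: power_Suc)
qed

text \<open>Completing the square gives \<open>y ^ (2 * m) - ((y - \<epsilon> ^ (h - 1)) /
  \<epsilon> ^ h) ^ 2\<close>, and the hypothesis on \<open>y\<close> turns the second square into
  \<open>x ^ (2 * m)\<close>. With \<open>x = y\<close> this shows that fixed points are roots; with
  \<open>x\<close> the preceding iterate it gives the value along the iteration.\<close>

lemma poly_tetranomial_iterate:
  fixes \<epsilon> \<sigma> x y :: "'a::field"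
  assumes "\<epsilon> \<noteq> 0" "h \<ge> 1" "\<sigma> * \<sigma> = 1" and y: "y = \<epsilon> ^ (h - 1) + \<sigma> * \<epsilon> ^ h * x ^ m"
  shows "poly (tetranomial h (2 * m) \<epsilon>) y = y ^ (2 * m) - x ^ (2 * m)"
proof -
  obtain k where k: "h = Suc k"
    using \<open>h \<ge> 1\<close> by (cases h) auto
  have powers: "\<epsilon> ^ (2 * h) = (\<epsilon> * \<epsilon> ^ k) ^ 2" "\<epsilon> ^ (h + 1) = \<epsilon> * \<epsilon> ^ k * \<epsilon>" "\<epsilon> ^ h = \<epsilon> * \<epsilon> ^ k"
    by (simp_all only: k power_even_eq power_Suc power_add power_one_right)
  have square: "((y - e) / (\<epsilon> * e)) ^ 2
      = 1 / (\<epsilon> * e) ^ 2 * y ^ 2 - 2 / (\<epsilon> * e * \<epsilon>) * y + 1 / \<epsilon> ^ 2" if "e \<noteq> 0" for e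
    using that \<open>\<epsilon> \<noteq> 0\<close> by (simp add: field_simps power2_eq_square)
  have "poly (tetranomial h (2 * m) \<epsilon>) y = y ^ (2 * m) - ((y - \<epsilon> ^ k) / \<epsilon> ^ h) ^ 2"
    using square[of "\<epsilon> ^ k"] \<open>\<epsilon> \<noteq> 0\<close> powers by (simp add: tetranomial_eq poly_monom)
  also have "(y - \<epsilon> ^ k) / \<epsilon> ^ h = \<sigma> * x ^ m"
    using \<open>\<epsilon> \<noteq> 0\<close> by (simp add: y k)
  also have "(\<sigma> * x ^ m) ^ 2 = x ^ (2 * m)"
    using \<open>\<sigma> * \<sigma> = 1\<close> by (simp add: power_mult_distrib power2_eq_square mult_2 power_add)
  finally show ?thesis .
qed

lemma tetranomial_nonzero: "d > 2 \<Longrightarrow> tetranomial h d \<epsilon> \<noteq> 0"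
proof -
  assume "d > 2"
  then have "Polynomial.coeff (tetranomial h d \<epsilon>) d = 1"
    by (simp add: tetranomial_def)
  then show ?thesis
    by auto
qed

lemma tetra_H_ge_1: "b \<ge> 1 \<Longrightarrow> tetra_H h b = b ^ (2 * h)"
  unfolding tetra_H_def
  using power_int_increasing[of "- 2 * int h" "2 * int h" b] power_int_of_nat[of b "2 * h"] by simp

text \<open>The maximum is invariant under inverting \<epsilon>, which reduces 1/2 to 2.\<close>

lemma tetra_H_half: "tetra_H h (1/2) = 2 ^ (2 * h)"
proof -
  have "tetra_H h (1/2) = tetra_H h 2"
    unfolding tetra_H_def
    by (simp add: max.commute power_int_divide_distrib power_int_minus field_simps)
  then show ?thesis
    by (simp add: tetra_H_ge_1)
qed

text \<open>The factor \<open>p ^ (2 * h)\<close> clears all denominators. The largest absolute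
  value among the resulting coefficients is \<open>p ^ (2 * h)\<close> itself, which has
  \<open>2 * h + 1\<close> digits.\<close>

lemma scaled_tetranomial_coeff:
  fixes p h d :: nat
  assumes "p > 1" "d \<ge> 4" "h \<ge> 1"
  obtains z :: int where
    "Polynomial.coeff (Polynomial.smult (of_nat p ^ (2 * h)) (tetranomial h d (of_nat p :: rat))) i = of_int z"
    "floorlog p (nat \<bar>z\<bar>) \<le> 2 * h + 1"
proof -
  define z :: int where "z = (if i = d then int p ^ (2 * h) else if i = 2 then -1
    else if i = 1 then 2 * int p ^ (h - 1) else if i = 0 then - (int p ^ (2 * h - 2)) else 0)"
  obtain k where k: "h = Suc k"
    using \<open>h \<ge> 1\<close> by (cases h) auto
  let ?p = "of_nat p :: rat"
  have p: "?p \<noteq> 0"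
    using \<open>p > 1\<close> by simp
  have "Polynomial.coeff (Polynomial.smult (?p ^ (2 * h)) (tetranomial h d ?p)) i = of_int z"
    unfolding tetranomial_eq z_def using \<open>d \<ge> 4\<close> p
    by (auto simp: k field_simps power_add power2_eq_square mult_2_right)
  moreover have "floorlog p (nat \<bar>z\<bar>) \<le> 2 * h + 1"
  proof (rule floorlog_leI)
    have "\<bar>z\<bar> \<le> int p ^ (2 * h)"
    proof -
      \<comment> \<open>The factor 2 of the linear coefficient is absorbed by one further factor
        \<open>p\<close>.\<close>
      have "int p ^ k \<le> int p ^ (2 * k)" "int p * int p ^ k \<ge> 2 * int p ^ k"
        using \<open>p > 1\<close> by (auto intro!: power_increasing)
      moreover have "int p ^ (2 * k) \<le> int p ^ (2 * h)" "int p ^ Suc k \<le> int p ^ (2 * h)"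
         "1 \<le> int p ^ (2 * h)"
        using \<open>p > 1\<close> unfolding k by (auto intro!: power_increasing one_le_power simp del: power_Suc)
      ultimately show ?thesis
        by (auto simp: z_def k)
    qed
    also have "\<dots> < int p ^ (2 * h + 1)"
      using \<open>p > 1\<close> by (intro power_strict_increasing) auto
    finally show "nat \<bar>z\<bar> < p ^ (2 * h + 1)"
      by (simp add: nat_less_iff del: power_Suc)
  qed (use \<open>p > 1\<close> in auto)
  ultimately show thesis
    by (rule that)
qed

section \<open>The real roots\<close>

text \<open>On the interval from 0 to \<open>2 * a\<close> the power term is at most
  \<open>a / 2\<close> in size, so \<open>?g\<close> changes sign there and no zero can sit at 0.
  For \<epsilon> = 1/2, the values are \<open>a = \<epsilon> ^ (h - 1)\<close> and
  \<open>a / 2 = \<epsilon> ^ h\<close>.\<close>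

lemma real_fixed_point:
  fixes a \<sigma> :: real
  assumes a: "0 < a" "a \<le> 1/4" and \<sigma>: "\<bar>\<sigma>\<bar> = 1" and "m \<ge> 1"
  obtains x where "0 < x" "x \<le> 2 * a" "x = a + \<sigma> * (a / 2) * x ^ m"
proof -
  let ?g = "\<lambda>x. a + \<sigma> * (a / 2) * x ^ m - x"
  have bound: "\<bar>\<sigma> * (a / 2) * x ^ m\<bar> \<le> a / 2" if "0 \<le> x" "x \<le> 2 * a" for x
  proof -
    have "x ^ m \<le> 1"
      using that a by (intro power_le_one) auto
    then show ?thesis
      using that a \<sigma> by (simp add: abs_mult mult_left_le)
  qed
  have "\<exists>x\<ge>0. x \<le> 2 * a \<and> ?g x = 0"
  proof (rule IVT2)
    show "?g (2 * a) \<le> 0"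
      using bound[of "2 * a"] a by linarith
    show "0 \<le> ?g 0"
      using bound[of 0] a by linarith
  qed (use a in auto)
  then obtain x where x: "0 \<le> x" "x \<le> 2 * a" "?g x = 0"
    by blast
  have "x > 0"
    using bound[of x] x a by linarith
  with x show thesis
    by (intro that[of x]) auto
qed

text \<open>The fixed points for the two signs differ by \<open>(a / 2) * (x ^ m + y ^ m)\<close>.
  This is positive, hence they are distinct, and small because both are at most
  \<open>2 * a = (1/2) ^ (h - 2)\<close>.\<close>

lemma real_roots:
  fixes h m :: nat
  assumes h: "h \<ge> 3" and m: "m \<ge> 1"
  obtains x y :: real where "x \<noteq> y" "0 < x" "x < 1" "0 < y" "y < 1"
    "poly (tetranomial h (2 * m) (1/2)) x = 0" "poly (tetranomial h (2 * m) (1/2)) y = 0"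
    "ln \<bar>x - y\<bar> \<le> - (real m * real (h - 2) * ln 2)"
proof -
  define a :: real where "a = (1/2) ^ (h - 1)"
  have half: "(1/2) ^ h = a / 2" and a2: "2 * a = (1/2) ^ (h - 2)"
    using h by (simp_all add: a_def flip: power_Suc) (simp_all add: power_diff field_simps)
  have a: "0 < a" "a \<le> 1/4"
    using h power_decreasing[of 2 "h - 1" "1/2 :: real"] by (simp_all add: a_def power2_eq_square)
  obtain x where x: "0 < x" "x \<le> 2 * a" "x = a + 1 * (a / 2) * x ^ m"
    using real_fixed_point[OF a _ m, of 1] by auto
  obtain y where y: "0 < y" "y \<le> 2 * a" "y = a + (-1) * (a / 2) * y ^ m"
    using real_fixed_point[OF a _ m, of "-1"] by auto
  have root: "poly (tetranomial h (2 * m) (1/2)) z = 0"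
    if "z = a + \<sigma> * (a / 2) * z ^ m" "\<sigma> * \<sigma> = 1" for z \<sigma> :: real
    using poly_tetranomial_iterate[of "1/2" h \<sigma> z z m] that h unfolding half a_def[symmetric] by simp
  have diff: "x - y = (a / 2) * (x ^ m + y ^ m)"
    using x(3) y(3) by (simp add: algebra_simps)
  have pos: "x - y > 0"
    unfolding diff using a x y by (simp add: add_pos_pos)
  have "x ^ m + y ^ m \<le> (2 * a) ^ m + (2 * a) ^ m"
    using x y by (intro add_mono power_mono) auto
  then have "x - y \<le> (a / 2) * ((2 * a) ^ m + (2 * a) ^ m)"
    unfolding diff using a by (intro mult_left_mono) auto
  also have "\<dots> \<le> (2 * a) ^ m"
    using a by (simp add: mult_left_le)
  finally have "ln (x - y) \<le> ln ((2 * a) ^ m)"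
    using pos a by simp
  also have "\<dots> = - (real m * real (h - 2) * ln 2)"
    by (simp add: a2 ln_realpow ln_div power_mult[symmetric])
  finally have "ln \<bar>x - y\<bar> \<le> - (real m * real (h - 2) * ln 2)"
    using pos by simp
  then show thesis
    using that[of x y] x y a pos root[OF x(3)] root[OF y(3)] by simp
qed

section \<open>The p-adic roots\<close>

primrec tetra_iter :: "nat \<Rightarrow> nat \<Rightarrow> nat \<Rightarrow> int \<Rightarrow> nat \<Rightarrow> int" where
  "tetra_iter p h m \<sigma> 0 = 0"
| "tetra_iter p h m \<sigma> (Suc n) = int p ^ (h - 1) + \<sigma> * int p ^ h * tetra_iter p h m \<sigma> n ^ m"

lemma tetra_iter_dvd: "int p ^ (h - 1) dvd tetra_iter p h m \<sigma> n"
proof (cases n)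
  case (Suc k)
  have "int p ^ (h - 1) dvd int p ^ h"
    by (intro le_imp_power_dvd) simp
  then show ?thesis
    by (simp add: Suc)
qed simp

text \<open>The map is a p-adic contraction: a difference divides the difference of the
  \<open>m\<close>-th powers, and the factor \<open>p ^ h\<close> supplies at least one more
  \<open>p\<close> per step.\<close>

lemma tetra_iter_coherent: "h \<ge> 1 \<Longrightarrow> padic_coherent p (tetra_iter p h m \<sigma>)"
  unfolding padic_coherent_def
proof
  fix n
  let ?x = "tetra_iter p h m \<sigma>"
  assume h: "h \<ge> 1"
  show "int p ^ n dvd ?x (Suc n) - ?x n"
  proof (induction n)
    case (Suc n)
    have "?x (Suc n) - ?x n dvd ?x (Suc n) ^ m - ?x n ^ m"
      by (metis dvd_def power_diff_sumr2)
    with Suc have "int p ^ n dvd ?x (Suc n) ^ m - ?x n ^ m"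
      using dvd_trans by blast
    moreover have "int p dvd int p ^ h"
      using h by simp
    ultimately have "int p * int p ^ n dvd int p ^ h * (?x (Suc n) ^ m - ?x n ^ m)"
      by (rule mult_dvd_mono[rotated])
    moreover have "?x (Suc (Suc n)) - ?x (Suc n) = \<sigma> * (int p ^ h * (?x (Suc n) ^ m - ?x n ^ m))"
      by (simp add: algebra_simps)
    ultimately show ?case
      by (metis dvd_mult power_Suc)
  qed simp
qed

text \<open>Fixes the exact valuation \<open>h - 1\<close> of every iterate after the initial 0;
  both nonvanishing and distinctness of the limits rest on it.\<close>

lemma tetra_iter_unit_part:
  assumes "p > 1" "h \<ge> 1" "n \<ge> 1"
  obtains u where "tetra_iter p h m \<sigma> n = int p ^ (h - 1) * u" "coprime (int p) u"
proof -
  obtain k where k: "n = Suc k"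
    using \<open>n \<ge> 1\<close> by (cases n) auto
  obtain g where g: "h = Suc g"
    using \<open>h \<ge> 1\<close> by (cases h) auto
  let ?u = "1 + int p * (\<sigma> * tetra_iter p h m \<sigma> k ^ m)"
  have "tetra_iter p h m \<sigma> n = int p ^ (h - 1) * ?u"
    by (simp add: k g algebra_simps)
  moreover have "coprime (int p) ?u"
    by (metis add.commute coprime_1_right coprime_iff_gcd_eq_1 gcd_add_mult mult.commute)
  ultimately show thesis
    by (rule that)
qed

lemma tetra_iter_diff:
  "tetra_iter p h m 1 (Suc n) - tetra_iter p h m (-1) (Suc n)
    = int p ^ h * (tetra_iter p h m 1 n ^ m + tetra_iter p h m (-1) n ^ m)"
  by (simp add: algebra_simps)

lemma tetra_iter_diff_dvd:
  "int p ^ (h + m * (h - 1)) dvd tetra_iter p h m 1 (Suc n) - tetra_iter p h m (-1) (Suc n)"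
proof -
  have "int p ^ (m * (h - 1)) dvd tetra_iter p h m \<sigma> n ^ m" for \<sigma>
    using dvd_power_same[OF tetra_iter_dvd] by (metis mult.commute power_mult)
  then show ?thesis
    unfolding tetra_iter_diff power_add by (intro mult_dvd_mono dvd_add) auto
qed

context
  fixes p :: nat
  assumes prime_p: "Factorial_Ring.prime p"
begin

abbreviation tetra_root :: "nat \<Rightarrow> nat \<Rightarrow> int \<Rightarrow> (nat \<Rightarrow> rat) set" where
  "tetra_root h m \<sigma> \<equiv> padic_of_seq p (\<lambda>n. of_int (tetra_iter p h m \<sigma> n))"

lemma p_gt_1: "p > 1"
  using prime_p by (rule prime_gt_1_nat)

lemma tetra_iter_Cauchy: "h \<ge> 1 \<Longrightarrow> padic_Cauchy p (\<lambda>n. of_int (tetra_iter p h m \<sigma> n))"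
  using padic_coherent_Cauchy[OF prime_p tetra_iter_coherent] by blast

lemma tetra_root_closed: "h \<ge> 1 \<Longrightarrow> tetra_root h m \<sigma> \<in> carrier (Qp p)"
  using padic_of_seq_closed[OF prime_p tetra_iter_Cauchy] by blast

text \<open>At an iterate the polynomial takes the value \<open>z n\<close>, a difference of equal
  powers of consecutive iterates. It is divisible by the difference of these iterates, hence by
  \<open>p ^ n\<close>.\<close>

lemma padic_root_tetra_root:
  assumes "h \<ge> 1" "m \<ge> 2" "\<sigma> * \<sigma> = 1"
  shows "padic_root p (tetranomial h (2 * m) (of_nat p)) (tetra_root h m \<sigma>)"
proof (rule padic_rootI[OF prime_p tetra_iter_Cauchy[OF assms(1)]])
  show "tetranomial h (2 * m) (of_nat p :: rat) \<noteq> 0"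
    using assms(2) by (intro tetranomial_nonzero) auto
  let ?x = "tetra_iter p h m \<sigma>"
  let ?f = "\<lambda>n. poly (tetranomial h (2 * m) (of_nat p :: rat)) (of_int (?x n))"
  define z where "z n = ?x (Suc n) ^ (2 * m) - ?x n ^ (2 * m)" for n
  have f: "?f (Suc n) = of_int (z n)" for n
  proof -
    have "of_int \<sigma> * of_int \<sigma> = (1 :: rat)"
      using assms(3) by (metis of_int_1 of_int_mult)
    then show ?thesis
      using poly_tetranomial_iterate[of "of_nat p :: rat" h "of_int \<sigma>" "of_int (?x (Suc n))" "of_int (?x n)" m]
        assms(1) p_gt_1
      by (simp add: z_def)
  qed
  have "int p ^ k dvd z n" if "n \<ge> k" for n k
  proof -
    have "int p ^ k dvd int p ^ n"
      using that by (rule le_imp_power_dvd)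
    also have "\<dots> dvd ?x (Suc n) - ?x n"
      using tetra_iter_coherent[OF assms(1)] by (simp add: padic_coherent_def)
    also have "\<dots> dvd z n"
      unfolding z_def by (metis dvd_def power_diff_sumr2)
    finally show ?thesis .
  qed
  then have "(\<lambda>n. of_int (z n)) \<in> padic_null p"
    unfolding padic_null_of_int_iff[OF prime_p] eventually_sequentially by blast
  then have "(\<lambda>n. padic_abs p (?f (Suc n))) \<longlonglongrightarrow> 0"
    by (simp only: f padic_null_def mem_Collect_eq)
  then show "?f \<in> padic_null p"
    unfolding padic_null_def mem_Collect_eq by (rule LIMSEQ_imp_Suc)
qed

lemma tetra_root_norm_le:
  assumes "h \<ge> 1"
  shows "padic_norm p (tetra_root h m \<sigma>) \<le> real p powi (- int (h - 1))"
  using tetra_iter_dvd tetra_iter_Cauchy[OF assms]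
  by (intro padic_norm_of_int_seq_le[OF prime_p]) auto

lemma tetra_root_norm_less_1: "h \<ge> 2 \<Longrightarrow> padic_norm p (tetra_root h m \<sigma>) < 1"
  using tetra_root_norm_le[of h m \<sigma>] p_gt_1
    power_int_strict_increasing[of "- int (h - 1)" 0 "real p"] by simp

text \<open>A zero limit would make \<open>p ^ h\<close> divide all late iterates, against their
  valuation \<open>h - 1\<close>.\<close>

lemma tetra_root_nonzero:
  assumes "h \<ge> 1"
  shows "tetra_root h m \<sigma> \<noteq> \<zero>\<^bsub>Qp p\<^esub>"
proof
  assume "tetra_root h m \<sigma> = \<zero>\<^bsub>Qp p\<^esub>"
  then have "\<forall>\<^sub>F n in sequentially. int p ^ h dvd tetra_iter p h m \<sigma> n"
    using padic_of_seq_eq_zero_iff[OF prime_p tetra_iter_Cauchy[OF assms]]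
      padic_null_of_int_iff[OF prime_p] by blast
  then obtain n where n: "n \<ge> 1" "int p ^ h dvd tetra_iter p h m \<sigma> n"
    using eventually_happens'[OF sequentially_bot eventually_conj[OF eventually_ge_at_top[of 1]]]
    by blast
  obtain u where u: "tetra_iter p h m \<sigma> n = int p ^ (h - 1) * u" "coprime (int p) u"
    using tetra_iter_unit_part[OF p_gt_1 assms n(1)] by blast
  have "int p ^ h = int p ^ (h - 1) * int p"
    using assms by (cases h) auto
  then have "int p dvd u"
    using n(2) p_gt_1 by (simp add: u(1))
  then show False
    using u(2) p_gt_1 by (simp add: coprime_absorb_left)
qed

text \<open>If the limits agreed, late iterates of both kinds would be congruent modulo a high power
  of \<open>p\<close>. Read at \<open>Suc n\<close> this concerns the sum of the \<open>m\<close>-th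
  powers at \<open>n\<close>, read at \<open>n\<close> their difference; adding the two contradicts
  the exact valuation of \<open>?x n\<close>.\<close>

lemma tetra_roots_distinct:
  assumes "h \<ge> 1"
  shows "tetra_root h m 1 \<noteq> tetra_root h m (-1)"
proof
  let ?x = "tetra_iter p h m 1" and ?y = "tetra_iter p h m (-1)"
  \<comment> \<open>The term \<open>m * (h - 1)\<close> is the valuation of \<open>?x n ^ m\<close>.
    A surplus of 2 rather than 1 is taken because for \<open>p = 2\<close> the factor 2 below
    absorbs one power of \<open>p\<close>.\<close>
  define k where "k = m * (h - 1) + 2"
  assume eq: "tetra_root h m 1 = tetra_root h m (-1)"
  interpret ring "Qp p"
    using ring_hom_padic_of_seq[OF prime_p] by (rule ring_hom_ring.axioms(2))
  have "padic_of_seq p (\<lambda>n. of_int (?x n) - of_int (?y n)) = \<zero>\<^bsub>Qp p\<^esub>"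
    using padic_of_seq_diff[OF prime_p tetra_iter_Cauchy[OF assms] tetra_iter_Cauchy[OF assms]]
      eq r_right_minus_eq[OF tetra_root_closed[OF assms] tetra_root_closed[OF assms]]
    by metis
  then have "(\<lambda>n. of_int (?x n - ?y n)) \<in> padic_null p"
    using padic_of_seq_eq_zero_iff[OF prime_p
        padic_Cauchy_diff[OF prime_p tetra_iter_Cauchy[OF assms] tetra_iter_Cauchy[OF assms]]]
    by simp
  then obtain n0 where "\<And>n. n \<ge> n0 \<Longrightarrow> int p ^ (h + k) dvd ?x n - ?y n"
    unfolding padic_null_of_int_iff[OF prime_p] eventually_sequentially by meson
  then obtain n where n: "n \<ge> 1" "int p ^ (h + k) dvd ?x n - ?y n"
      "int p ^ (h + k) dvd ?x (Suc n) - ?y (Suc n)"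
    by (metis le_Suc_eq max.cobounded1 max.cobounded2)
  have "int p ^ k dvd ?x n ^ m + ?y n ^ m"
    using n(3) p_gt_1 unfolding tetra_iter_diff power_add by simp
  moreover have "int p ^ k dvd ?x n ^ m - ?y n ^ m"
  proof -
    have "int p ^ k dvd int p ^ (h + k)"
      by (simp add: le_imp_power_dvd)
    also note n(2)
    also have "?x n - ?y n dvd ?x n ^ m - ?y n ^ m"
      by (metis dvd_def power_diff_sumr2)
    finally show ?thesis .
  qed
  ultimately have dvd: "int p ^ k dvd 2 * ?x n ^ m"
    using dvd_add by fastforce
  obtain u where u: "?x n = int p ^ (h - 1) * u" "coprime (int p) u"
    using tetra_iter_unit_part[OF p_gt_1 assms n(1)] by blast
  have "int p ^ (m * (h - 1)) * int p ^ 2 dvd int p ^ (m * (h - 1)) * (2 * u ^ m)"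
    using dvd by (simp only: u(1) k_def power_add power_mult_distrib power_mult[symmetric] mult_ac)
  then have "int p ^ 2 dvd 2 * u ^ m"
    using p_gt_1 by (subst (asm) dvd_mult_cancel_left) simp
  moreover have "coprime (int p ^ 2) (u ^ m)"
    using u(2) by simp
  ultimately have "int p ^ 2 dvd 2"
    by (simp add: coprime_dvd_mult_left_iff)
  then have "int p ^ 2 \<le> 2"
    by (rule zdvd_imp_le) simp
  moreover have "int p ^ 2 \<ge> 2 ^ 2"
    using p_gt_1 by (intro power_mono) auto
  ultimately show False
    by simp
qed

lemma tetra_roots_close:
  assumes "h \<ge> 1"
  shows "padic_norm p (tetra_root h m 1 \<ominus>\<^bsub>Qp p\<^esub> tetra_root h m (-1))
    \<le> real p powi (- int (h + m * (h - 1)))"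
proof -
  have "\<forall>\<^sub>F n in sequentially.
      int p ^ (h + m * (h - 1)) dvd tetra_iter p h m 1 n - tetra_iter p h m (-1) n"
    \<comment> \<open>The divisibility is available at successor indices, hence the shift of the
      filter.\<close>
    using tetra_iter_diff_dvd by (subst eventually_sequentially_Suc[symmetric]) auto
  then show ?thesis
    using padic_norm_of_int_seq_le[OF prime_p, of "\<lambda>n. tetra_iter p h m 1 n - tetra_iter p h m (-1) n"]
      padic_Cauchy_diff[OF prime_p tetra_iter_Cauchy[OF assms] tetra_iter_Cauchy[OF assms]]
    unfolding padic_of_seq_diff[OF prime_p tetra_iter_Cauchy[OF assms] tetra_iter_Cauchy[OF assms]]
      of_int_diff
    by blast
qed

lemma tetra_roots_digits_agree:
  assumes "h \<ge> 1" "i < h + m * (h - 1)"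
  shows "padic_digits p (tetra_root h m 1) i = padic_digits p (tetra_root h m (-1)) i"
proof -
  have digits: "is_padic_expansion p (padic_digits p (tetra_root h m \<sigma>)) (tetra_root h m \<sigma>)" for \<sigma>
    using padic_digits_eq[OF prime_p tetra_root_closed[OF assms(1)]]
      padic_coherent_expansion[OF prime_p tetra_iter_coherent[OF assms(1)]]
    by metis
  show ?thesis
    by (rule padic_expansions_agree[OF prime_p tetra_root_closed tetra_root_closed digits digits
          tetra_roots_close assms(2)])
       (rule assms(1))+
qed

text \<open>Distinctness makes the norm of the difference positive, so the bound on it may be passed
  through \<open>ln\<close>.\<close>

lemma tetra_roots_ln_le:
  assumes "h \<ge> 1"
  shows "ln (padic_norm p (tetra_root h m 1 \<ominus>\<^bsub>Qp p\<^esub> tetra_root h m (-1)))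
    \<le> - (real (h + m * (h - 1)) * ln (real p))"
proof -
  interpret ring "Qp p"
    using ring_hom_padic_of_seq[OF prime_p] by (rule ring_hom_ring.axioms(2))
  let ?z = "tetra_root h m 1 \<ominus>\<^bsub>Qp p\<^esub> tetra_root h m (-1)" and ?N = "h + m * (h - 1)"
  have "?z \<in> carrier (Qp p)" "?z \<noteq> \<zero>\<^bsub>Qp p\<^esub>"
    using r_right_minus_eq[OF tetra_root_closed[OF assms] tetra_root_closed[OF assms]]
      tetra_roots_distinct[OF assms] minus_closed[OF tetra_root_closed[OF assms] tetra_root_closed[OF assms]]
    by auto
  then have "padic_norm p ?z > 0"
    by (rule padic_norm_pos[OF prime_p])
  then have "ln (padic_norm p ?z) \<le> ln (real p powi (- int ?N))"
    using tetra_roots_close[OF assms] p_gt_1 by (subst ln_le_cancel_iff) auto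
  also have "\<dots> = - (real ?N * ln (real p))"
    using p_gt_1 ln_realpow[of "real p" ?N] power_int_minus[of "real p" "int ?N"]
    by (simp only: power_int_of_nat) (simp add: ln_inverse)
  finally show ?thesis .
qed

end

theorem theorem1p5:
  shows "\<exists>c>0. \<exists>C>0. \<forall>h d :: nat.
    h \<ge> 3 \<and> d \<in> {4..nat \<lfloor>exp (real h)\<rfloor>} \<and> even d \<longrightarrow>
    (\<exists>\<zeta>\<^sub>1 \<zeta>\<^sub>2 :: real.
        \<zeta>\<^sub>1 \<noteq> \<zeta>\<^sub>2 \<and> \<zeta>\<^sub>1 \<noteq> 0 \<and> \<zeta>\<^sub>2 \<noteq> 0 \<and> \<bar>\<zeta>\<^sub>1\<bar> < 1 \<and> \<bar>\<zeta>\<^sub>2\<bar> < 1 \<and>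
        poly (tetranomial h d (1/2)) \<zeta>\<^sub>1 = 0 \<and> poly (tetranomial h d (1/2)) \<zeta>\<^sub>2 = 0 \<and>
        \<bar>ln \<bar>\<zeta>\<^sub>1 - \<zeta>\<^sub>2\<bar>\<bar> \<ge> c * (real d * ln (tetra_H h (1/2)))) \<and>
    (\<forall>p :: nat. Factorial_Ring.prime p \<longrightarrow>
      (\<exists>\<zeta>\<^sub>1 \<zeta>\<^sub>2.
        \<zeta>\<^sub>1 \<noteq> \<zeta>\<^sub>2 \<and> \<zeta>\<^sub>1 \<noteq> \<zero>\<^bsub>Qp p\<^esub> \<and> \<zeta>\<^sub>2 \<noteq> \<zero>\<^bsub>Qp p\<^esub> \<and>
        padic_norm p \<zeta>\<^sub>1 < 1 \<and> padic_norm p \<zeta>\<^sub>2 < 1 \<and>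
        padic_root p (tetranomial h d (of_nat p)) \<zeta>\<^sub>1 \<and>
        padic_root p (tetranomial h d (of_nat p)) \<zeta>\<^sub>2 \<and>
        \<bar>ln (padic_norm p (\<zeta>\<^sub>1 \<ominus>\<^bsub>Qp p\<^esub> \<zeta>\<^sub>2))\<bar> \<ge> c * (real d * ln (tetra_H h (real p)))) \<and>
      (\<forall>i. \<exists>z :: int.
        Polynomial.coeff (Polynomial.smult (of_nat p ^ (2 * h)) (tetranomial h d (of_nat p :: rat))) i = of_int z \<and>
        real (floorlog p (nat \<bar>z\<bar>)) \<le> C * log (real p) (tetra_H h (real p))) \<and>
      (\<forall>k. padic_distinguishes p k {\<zeta> \<in> Zp p. padic_root p (tetranomial h d (of_nat p)) \<zeta>} \<longrightarrow>
        real k \<ge> c * (real d * log (real p) (tetra_H h (real p)))))"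
\<comment> \<open>With \<open>d = 2 * m\<close> and \<open>log H\<close> equal to
  \<open>2 * h\<close> units, \<open>d * log H\<close> is \<open>4 * m * h\<close> units, while the
  roots are at least \<open>m * (h - 2)\<close> units apart on the logarithmic scale. Since
  \<open>h - 2 \<ge> h / 3\<close> for \<open>h \<ge> 3\<close>, the factor 1/12 suffices. The
  factor 2 covers the digit count, as \<open>2 * h + 1 \<le> 4 * h\<close>.\<close>
proof (rule exI[of _ "1/12"], rule conjI, simp, rule exI[of _ 2], rule conjI, simp, intro allI impI,
    elim conjE)
  fix h d :: nat
  assume h: "h \<ge> 3" and d_range: "d \<in> {4..nat \<lfloor>exp (real h)\<rfloor>}" and "even d"
  then obtain m where d: "d = 2 * m" and m: "m \<ge> 2"
    by (auto elim!: evenE)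
  have h1: "h \<ge> 1" "h \<ge> 2" and m1: "m \<ge> 1"
    using h m by auto
  have bound: "1/12 * (real d * (2 * real h)) \<le> real m * real (h - 2)"
    using h mult_left_mono[of "real h / 3" "real (h - 2)" "real m"] by (simp add: d mult.commute)
  have bound': "1/12 * (real d * (2 * real h)) \<le> real (h + m * (h - 1))"
  proof -
    have "m * (h - 2) \<le> h + m * (h - 1)"
      by (intro trans_le_add2 mult_le_mono2) simp
    then show ?thesis
      using bound by (metis of_nat_le_iff of_nat_mult order_trans)
  qed
  \<comment> \<open>Common to both fields: \<open>l\<close> is \<open>ln 2\<close> or
    \<open>ln p\<close>, and \<open>t\<close> is the exponent in the upper bound for the
    distance.\<close>
  have scaled: "1/12 * (real d * ln H) \<le> \<bar>r\<bar>"
    if "ln H = 2 * real h * l" "r \<le> - (t * l)" "1/12 * (real d * (2 * real h)) \<le> t" "l \<ge> 0"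
    for H l r t :: real
  proof -
    have "1/12 * (real d * ln H) = 1/12 * (real d * (2 * real h)) * l"
      by (simp add: that(1))
    also have "\<dots> \<le> t * l"
      using that(3,4) by (rule mult_right_mono)
    finally show ?thesis
      using that(2) by linarith
  qed
  show "(\<exists>\<zeta>\<^sub>1 \<zeta>\<^sub>2 :: real.
        \<zeta>\<^sub>1 \<noteq> \<zeta>\<^sub>2 \<and> \<zeta>\<^sub>1 \<noteq> 0 \<and> \<zeta>\<^sub>2 \<noteq> 0 \<and> \<bar>\<zeta>\<^sub>1\<bar> < 1 \<and> \<bar>\<zeta>\<^sub>2\<bar> < 1 \<and>
        poly (tetranomial h d (1/2)) \<zeta>\<^sub>1 = 0 \<and> poly (tetranomial h d (1/2)) \<zeta>\<^sub>2 = 0 \<and>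
        \<bar>ln \<bar>\<zeta>\<^sub>1 - \<zeta>\<^sub>2\<bar>\<bar> \<ge> 1/12 * (real d * ln (tetra_H h (1/2)))) \<and>
    (\<forall>p :: nat. Factorial_Ring.prime p \<longrightarrow>
      (\<exists>\<zeta>\<^sub>1 \<zeta>\<^sub>2.
        \<zeta>\<^sub>1 \<noteq> \<zeta>\<^sub>2 \<and> \<zeta>\<^sub>1 \<noteq> \<zero>\<^bsub>Qp p\<^esub> \<and> \<zeta>\<^sub>2 \<noteq> \<zero>\<^bsub>Qp p\<^esub> \<and>
        padic_norm p \<zeta>\<^sub>1 < 1 \<and> padic_norm p \<zeta>\<^sub>2 < 1 \<and>
        padic_root p (tetranomial h d (of_nat p)) \<zeta>\<^sub>1 \<and>
        padic_root p (tetranomial h d (of_nat p)) \<zeta>\<^sub>2 \<and>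
        \<bar>ln (padic_norm p (\<zeta>\<^sub>1 \<ominus>\<^bsub>Qp p\<^esub> \<zeta>\<^sub>2))\<bar> \<ge> 1/12 * (real d * ln (tetra_H h (real p)))) \<and>
      (\<forall>i. \<exists>z :: int.
        Polynomial.coeff (Polynomial.smult (of_nat p ^ (2 * h)) (tetranomial h d (of_nat p :: rat))) i = of_int z \<and>
        real (floorlog p (nat \<bar>z\<bar>)) \<le> 2 * log (real p) (tetra_H h (real p))) \<and>
      (\<forall>k. padic_distinguishes p k {\<zeta> \<in> Zp p. padic_root p (tetranomial h d (of_nat p)) \<zeta>} \<longrightarrow>
        real k \<ge> 1/12 * (real d * log (real p) (tetra_H h (real p)))))"
  proof (rule conjI, goal_cases)
    case 1
    obtain x y :: real where xy: "x \<noteq> y" "0 < x" "x < 1" "0 < y" "y < 1"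
      "poly (tetranomial h d (1/2)) x = 0" "poly (tetranomial h d (1/2)) y = 0"
      and ln_le: "ln \<bar>x - y\<bar> \<le> - (real m * real (h - 2) * ln 2)"
      using real_roots[OF h m1] unfolding d by blast
    have "ln (tetra_H h (1/2)) = 2 * real h * ln 2"
      by (simp add: tetra_H_half ln_realpow)
    from scaled[OF this ln_le bound] xy show ?case
      by (intro exI[of _ x] exI[of _ y]) auto
  next
    case 2
    show ?case
    proof (intro allI impI, goal_cases)
      case (1 p)
      have p: "p > 1"
        using 1 by (rule prime_gt_1_nat)
      have H: "tetra_H h (real p) = real p ^ (2 * h)"
        using p by (intro tetra_H_ge_1) simp
      have log_H: "log (real p) (tetra_H h (real p)) = 2 * real h"
        using p by (simp add: H log_nat_power)
      have ln_H: "ln (tetra_H h (real p)) = 2 * real h * ln (real p)"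
        using p by (simp add: H ln_realpow)
      let ?x = "\<lambda>\<sigma>. padic_of_seq p (\<lambda>n. of_int (tetra_iter p h m \<sigma> n))"
      have root: "padic_root p (tetranomial h d (of_nat p)) (?x 1)"
        "padic_root p (tetranomial h d (of_nat p)) (?x (-1))"
        unfolding d using padic_root_tetra_root[OF 1 h1(1) m] by auto
      have close: "1/12 * (real d * ln (tetra_H h (real p))) \<le> \<bar>ln (padic_norm p (?x 1 \<ominus>\<^bsub>Qp p\<^esub> ?x (-1)))\<bar>"
        using scaled[OF ln_H tetra_roots_ln_le[OF 1 h1(1)] bound'] p by simp
      have coeffs: "\<exists>z :: int.
          Polynomial.coeff (Polynomial.smult (of_nat p ^ (2 * h)) (tetranomial h d (of_nat p :: rat))) i = of_int z \<and>
          real (floorlog p (nat \<bar>z\<bar>)) \<le> 2 * log (real p) (tetra_H h (real p))" for i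
      proof -
        obtain z :: int where z: "Polynomial.coeff (Polynomial.smult (of_nat p ^ (2 * h))
            (tetranomial h d (of_nat p :: rat))) i = of_int z" "floorlog p (nat \<bar>z\<bar>) \<le> 2 * h + 1"
          using scaled_tetranomial_coeff[OF p _ h1(1)] d_range by (metis atLeastAtMost_iff)
        then have "real (floorlog p (nat \<bar>z\<bar>)) \<le> 2 * (2 * real h)"
          using h by linarith
        then show ?thesis
          using z(1) log_H by auto
      qed
      let ?S = "{\<zeta> \<in> Zp p. padic_root p (tetranomial h d (of_nat p)) \<zeta>}"
      have digits: "1/12 * (real d * log (real p) (tetra_H h (real p))) \<le> real k"
        if dist: "padic_distinguishes p k ?S" for k
      proof -
        have "?x \<sigma> \<in> Zp p" for \<sigma>
          using tetra_root_closed[OF 1 h1(1)] tetra_root_norm_less_1[OF 1 h1(2)]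
          by (simp add: Zp_def less_imp_le)
        then have mem: "?x 1 \<in> ?S" "?x (-1) \<in> ?S"
          using root by simp_all
        have "\<exists>i<k. padic_digits p (?x 1) i \<noteq> padic_digits p (?x (-1)) i"
          using dist[unfolded padic_distinguishes_def, THEN bspec, OF mem(1), THEN bspec, OF mem(2)]
            tetra_roots_distinct[OF 1 h1(1), of m] by (rule mp)
        then obtain i where "i < k" "padic_digits p (?x 1) i \<noteq> padic_digits p (?x (-1)) i"
          by blast
        \<comment> \<open>The two roots share their first \<open>h + m * (h - 1)\<close> digits, so
          a position where they differ lies beyond that block.\<close>
        then have "h + m * (h - 1) \<le> k"
          using tetra_roots_digits_agree[OF 1 h1(1)] by (meson less_imp_le not_le order.strict_trans)
        then show ?thesis
          using bound' unfolding log_H by (meson of_nat_le_iff order_trans)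
      qed
      show ?case
        using root close coeffs digits tetra_roots_distinct[OF 1 h1(1)] tetra_root_nonzero[OF 1 h1(1)]
          tetra_root_norm_less_1[OF 1 h1(2)]
        by (intro conjI exI[of _ "?x 1"] exI[of _ "?x (-1)"] allI impI) blast+
    qed
  qed
qed

end
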